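(* Let $(X,\|\cdot,\dots,\cdot\|^{*})$ be an $n_1$-normed space and $(Z,\|\cdot,\dots,\cdot\|^{**})$ an $n_2$-normed space, with fixed linearly independent sets of $n_1$ vectors in $X$ and of $n_2$ vectors in $Z$, and let $l\in\{1,\dots,n_1\}$, $m\in\{1,\dots,n_2\}$. A mapping $f:X\to Z$ is continuous with respect to the norms of class-$(1,1)$ collections if and only if $f$ is continuous with respect to the norms of class-$(l,m)$ collections.
   Context: Let $n$ be a positive integer and $X$ a real vector space with $\dim X\ge n$. An $n$-norm on $X$ is a map $\|\cdot,\dots,\cdot\|:X^n\to\mathbb{R}$ such that (i) $\|x_1,\dots,x_n\|\ge 0$, with equality if and only if $x_1,\dots,x_n$ are linearly dependent; (ii) it is invariant under permutations of its arguments; (iii) $\|\alpha x_1,x_2,\dots,x_n\|=|\alpha|\,\|x_1,\dots,x_n\|$ for $\alpha\in\mathbb{R}$; (iv) $\|x_1+x_1',x_2,\dots,x_n\|\le\|x_1,x_2,\dots,x_n\|+\|x_1',x_2,\dots,x_n\|$. The pair $(X,\|\cdot,\dots,\cdot\|)$ is called an $n$-normed space. Fix a linearly independent set $Y=\{y_1,\dots,y_n\}\subset X$. For $m\in\{1,\dots,n\}$ and an $m$-element subset $\{i_1,\dots,i_m\}\subset\{1,\dots,n\}$, let $Y^0_{i_1,\dots,i_m}=\mathrm{span}\{y_i: i\notin\{i_1,\dots,i_m\}\}$, let $X^*_{i_1,\dots,i_m}=X/Y^0_{i_1,\dots,i_m}$, let $\overline{u}$ denote the coset of $u\in X$, and define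 the norm $$\|\overline{u}\|^*_{i_1,\dots,i_m}=\sum_{j=1}^m\|u,y_1,\dots,y_{i_j-1},y_{i_j+1},\dots,y_n\|$$ on $X^*_{i_1,\dots,i_m}$. The set of these $\binom{n}{m}$ quotient spaces is the class-$m$ collection, and their norms are "the norms of class-$m$ collection". For an $n_1$-normed space $X$ and an $n_2$-normed space $Z$ (each with a fixed linearly independent set of $n_1$, respectively $n_2$, vectors), denote the norms of class-$l$ collection of $X$ by $\|\cdot\|^*_{i_1,\dots,i_l}$ and those of class-$m$ collection of $Z$ by $\|\cdot\|^{**}_{j_1,\dots,j_m}$. A mapping $f:X\to Z$ is continuous with respect to the norms of class-$(l,m)$ collections at $a\in X$ if for every $\epsilon>0$ there is $\delta>0$ such that for every $x\in X$ with $\|\overline{x-a}\|^*_{i_1,\dots,i_l}<\delta$ for every $l$-element subset $\{i_1,\dots,i_l\}\subset\{1,\dots,n_1\}$, one has $\|\overline{f(x)-f(a)}\|^{**}_{j_1,\dots,j_m}<\epsilon$ for every $m$-element subset $\{j_1,\dots,j_m\}\subset\{1,\dots,n_2\}$. It is continuous with respect to the norms of class-$(l,m)$ collections (on $X$) if this holds at each $a\in X$. *)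

theory Defs
  imports Complex_Main "HOL-Library.Multiset"
begin

text \<open>
  An \<open>n\<close>-tuple of vectors is a list of length \<open>n\<close>; the values of \<open>N\<close> on lists of any other
  length are irrelevant.  The real vector space \<open>X\<close> is the whole type.  A tuple is linearly
  independent as a family iff it has no repeated entry and its set of entries is independent.
\<close>

locale n_normed_space =
  fixes n :: nat and N :: "'a::real_vector list \<Rightarrow> real"
  assumes n_pos: "n \<ge> 1"
    and dim_ge: "\<exists>B :: 'a set. independent B \<and> finite B \<and> card B = n"
    and nonneg: "\<And>xs. length xs = n \<Longrightarrow> N xs \<ge> 0"
    and eq_0_iff: "\<And>xs. length xs = n \<Longrightarrow> N xs = 0 \<longleftrightarrow> \<not> (distinct xs \<and> independent (set xs))"
    and perm: "\<And>xs zs. length xs = n \<Longrightarrow> mset zs = mset xs \<Longrightarrow> N zs = N xs"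
    and scale: "\<And>\<alpha> x xs. length (x # xs) = n \<Longrightarrow> N ((\<alpha> *\<^sub>R x) # xs) = \<bar>\<alpha>\<bar> * N (x # xs)"
    and triangle: "\<And>x x' xs. length (x # xs) = n \<Longrightarrow> N ((x + x') # xs) \<le> N (x # xs) + N (x' # xs)"

text \<open>The vectors \<open>y\<^sub>1, \<dots>, y\<^sub>n\<close> are given by a function that matters only on \<open>{1..n}\<close>.\<close>

definition omit_span :: "nat \<Rightarrow> (nat \<Rightarrow> 'a::real_vector) \<Rightarrow> nat set \<Rightarrow> 'a set" where
  "omit_span n y I = span (y ` ({1..n} - I))"

text \<open>Elements of the quotient space \<open>X / omit_span n y I\<close> are cosets, that is, sets of vectors.\<close>

definition quot_coset :: "nat \<Rightarrow> (nat \<Rightarrow> 'a::real_vector) \<Rightarrow> nat set \<Rightarrow> 'a \<Rightarrow> 'a set" where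
  "quot_coset n y I u = (\<lambda>v. u + v) ` omit_span n y I"

definition omit_norm_sum ::
    "nat \<Rightarrow> ('a::real_vector list \<Rightarrow> real) \<Rightarrow> (nat \<Rightarrow> 'a) \<Rightarrow> nat set \<Rightarrow> 'a \<Rightarrow> real" where
  "omit_norm_sum n N y I u = (\<Sum>i\<in>I. N (u # map y ([1..<i] @ [Suc i..<Suc n])))"

text \<open>
  The norm of a coset is the common value of the sum on all its representatives; that there is
  such a value is lemma \<open>quot_norm_coset\<close> below.
\<close>

definition quot_norm ::
    "nat \<Rightarrow> ('a::real_vector list \<Rightarrow> real) \<Rightarrow> (nat \<Rightarrow> 'a) \<Rightarrow> nat set \<Rightarrow> 'a set \<Rightarrow> real" where
  "quot_norm n N y I C = (THE r. \<forall>u\<in>C. omit_norm_sum n N y I u = r)"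

definition class_index :: "nat \<Rightarrow> nat \<Rightarrow> nat set set" where
  "class_index n m = {I. I \<subseteq> {1..n} \<and> card I = m}"

definition class_continuous_at ::
    "nat \<Rightarrow> ('a::real_vector list \<Rightarrow> real) \<Rightarrow> (nat \<Rightarrow> 'a) \<Rightarrow>
     nat \<Rightarrow> ('b::real_vector list \<Rightarrow> real) \<Rightarrow> (nat \<Rightarrow> 'b) \<Rightarrow>
     nat \<Rightarrow> nat \<Rightarrow> ('a \<Rightarrow> 'b) \<Rightarrow> 'a \<Rightarrow> bool" where
  "class_continuous_at n1 N1 y n2 N2 z l m f a \<longleftrightarrow>
     (\<forall>\<epsilon>>0. \<exists>\<delta>>0. \<forall>x.
        (\<forall>I\<in>class_index n1 l. quot_norm n1 N1 y I (quot_coset n1 y I (x - a)) < \<delta>) \<longrightarrow>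
        (\<forall>J\<in>class_index n2 m. quot_norm n2 N2 z J (quot_coset n2 z J (f x - f a)) < \<epsilon>))"

definition class_continuous ::
    "nat \<Rightarrow> ('a::real_vector list \<Rightarrow> real) \<Rightarrow> (nat \<Rightarrow> 'a) \<Rightarrow>
     nat \<Rightarrow> ('b::real_vector list \<Rightarrow> real) \<Rightarrow> (nat \<Rightarrow> 'b) \<Rightarrow>
     nat \<Rightarrow> nat \<Rightarrow> ('a \<Rightarrow> 'b) \<Rightarrow> bool" where
  "class_continuous n1 N1 y n2 N2 z l m f \<longleftrightarrow>
     (\<forall>a. class_continuous_at n1 N1 y n2 N2 z l m f a)"

context n_normed_space
begin

lemma add_dependent:
  assumes len: "Suc (length ws) = n" and v: "v \<in> span (set ws)"
  shows "N ((u + v) # ws) = N (u # ws)"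
proof -
  have z: "N (w # ws) = 0" if "w \<in> span (set ws)" for w
  proof -
    have "\<not> (distinct (w # ws) \<and> independent (set (w # ws)))"
      using that by (auto simp: independent_insert)
    then show ?thesis using eq_0_iff[of "w # ws"] len by simp
  qed
  have "N ((u + v) # ws) \<le> N (u # ws) + N (v # ws)"
    using triangle[of u ws v] len by simp
  moreover have "N (((u + v) + (- v)) # ws) \<le> N ((u + v) # ws) + N ((- v) # ws)"
    using triangle[of "u + v" ws "- v"] len by simp
  ultimately show ?thesis
    using z[OF v] z[of "- v"] v by (simp add: span_neg)
qed

lemma quot_norm_coset:
  assumes "I \<subseteq> {1..n}"
  shows "quot_norm n N y I (quot_coset n y I u) = omit_norm_sum n N y I u"
proof -
  have *: "omit_norm_sum n N y I (u + v) = omit_norm_sum n N y I u"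
    if v: "v \<in> omit_span n y I" for v
    unfolding omit_norm_sum_def
  proof (rule sum.cong[OF refl])
    fix i assume i: "i \<in> I"
    let ?ws = "map y ([1..<i] @ [Suc i..<Suc n])"
    have "i \<in> {1..n}" using i assms by auto
    then have len: "Suc (length ?ws) = n" by auto
    have "{1..n} - I \<subseteq> set ([1..<i] @ [Suc i..<Suc n])"
    proof
      fix k assume k: "k \<in> {1..n} - I"
      then have "k < i \<or> i < k" using i by (metis DiffD2 linorder_neqE_nat)
      then show "k \<in> set ([1..<i] @ [Suc i..<Suc n])" using k by auto
    qed
    then have "y ` ({1..n} - I) \<subseteq> set ?ws"
      unfolding set_map by (rule image_mono)
    then have "v \<in> span (set ?ws)"
      using v span_mono unfolding omit_span_def by blast
    then show "N ((u + v) # ?ws) = N (u # ?ws)"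
      using add_dependent[OF len] by blast
  qed
  have "0 \<in> omit_span n y I" by (simp add: omit_span_def span_zero)
  then have "u \<in> quot_coset n y I u"
    unfolding quot_coset_def by (force simp: image_iff)
  then show ?thesis
    unfolding quot_norm_def by (intro the_equality) (auto simp: quot_coset_def *)
qed

end

end

theory Submission
  imports Defs
begin

text \<open>By \<open>quot_norm_coset\<close>, the class-\<open>m\<close> norm of \<open>u\<close>
  for an index set \<open>I\<close> is the sum over \<open>i \<in> I\<close> of the class-1 norms of
  \<open>u\<close> for \<open>{i}\<close>. These are nonnegative, so a bound \<open>e\<close> on all
  class-\<open>m\<close> norms passes to all class-1 norms (\<open>class_norms_mono\<close>), and a
  bound \<open>e / m\<close> on the class-1 norms gives \<open>e\<close> on every sum of
  \<open>m\<close> of them (\<open>class_norms_less_of_class_1\<close>). Smallness in one class is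
  thus smallness in the other up to a constant factor, uniformly in \<open>u\<close>, and rescaling
  \<epsilon> and \<delta> carries continuity both ways at each point.\<close>

lemma (in n_normed_space) omit_norm_nonneg:
  assumes "i \<in> {1..n}"
  shows "N (u # map y ([1..<i] @ [Suc i..<Suc n])) \<ge> 0"
  using assms by (intro nonneg) auto

text \<open>A sum over \<open>K\<close> is a partial sum, with nonnegative terms omitted, of the sum
  over any \<open>m\<close>-element \<open>I\<close> containing \<open>K\<close>; such an
  \<open>I\<close> exists because \<open>m \<le> n\<close>.\<close>

lemma (in n_normed_space) class_norms_mono:
  assumes "1 \<le> k" "k \<le> m" "m \<le> n"
    and small: "\<forall>I\<in>class_index n m. quot_norm n N y I (quot_coset n y I u) < e"
  shows "\<forall>K\<in>class_index n k. quot_norm n N y K (quot_coset n y K u) < e"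
proof
  fix K assume "K \<in> class_index n k"
  then have K: "K \<subseteq> {1..n}" "card K = k" by (auto simp: class_index_def)
  then obtain I where I: "K \<subseteq> I" "I \<subseteq> {1..n}" "card I = m"
    using exists_subset_between[of K m "{1..n}"] assms by auto
  have "finite I" using I(2) finite_subset by blast
  then have "omit_norm_sum n N y K u \<le> omit_norm_sum n N y I u"
    unfolding omit_norm_sum_def using I omit_norm_nonneg by (intro sum_mono2) blast+
  also have "\<dots> < e"
    using small I by (auto simp: class_index_def quot_norm_coset)
  finally show "quot_norm n N y K (quot_coset n y K u) < e"
    using K by (simp add: quot_norm_coset)
qed

lemma (in n_normed_space) class_norms_less_of_class_1:
  assumes "m \<ge> 1"
    and small: "\<forall>I\<in>class_index n 1. quot_norm n N y I (quot_coset n y I u) < e / real m"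
  shows "\<forall>I\<in>class_index n m. quot_norm n N y I (quot_coset n y I u) < e"
proof
  fix I assume "I \<in> class_index n m"
  then have I: "I \<subseteq> {1..n}" "card I = m" by (auto simp: class_index_def)
  have "N (u # map y ([1..<i] @ [Suc i..<Suc n])) < e / real m" if "i \<in> I" for i
  proof -
    have "{i} \<subseteq> {1..n}" using I that by auto
    then have "omit_norm_sum n N y {i} u < e / real m"
      using small[rule_format, of "{i}"] quot_norm_coset[of "{i}" y u]
      by (simp add: class_index_def)
    then show ?thesis by (simp add: omit_norm_sum_def)
  qed
  \<comment> \<open>Strictness survives summation because \<open>I\<close> is nonempty, as
    \<open>m \<ge> 1\<close>.\<close>
  then have "omit_norm_sum n N y I u < (\<Sum>i\<in>I. e / real m)"
    unfolding omit_norm_sum_def using I assms(1) finite_subset[OF I(1)]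
    by (intro sum_strict_mono) auto
  also have "\<dots> = e" using I assms(1) by simp
  finally show "quot_norm n N y I (quot_coset n y I u) < e"
    using I by (simp add: quot_norm_coset)
qed

theorem theorem3p2:
  fixes n1 n2 l m :: nat
    and N1 :: "'a::real_vector list \<Rightarrow> real" and N2 :: "'b::real_vector list \<Rightarrow> real"
    and y :: "nat \<Rightarrow> 'a" and z :: "nat \<Rightarrow> 'b"
    and f :: "'a \<Rightarrow> 'b"
  assumes "n_normed_space n1 N1" and "n_normed_space n2 N2"
    and "inj_on y {1..n1}" and "independent (y ` {1..n1})"
    and "inj_on z {1..n2}" and "independent (z ` {1..n2})"
    and "l \<in> {1..n1}" and "m \<in> {1..n2}"
  shows "class_continuous n1 N1 y n2 N2 z 1 1 f \<longleftrightarrow> class_continuous n1 N1 y n2 N2 z l m f"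
proof -
  interpret X: n_normed_space n1 N1 by fact
  interpret Z: n_normed_space n2 N2 by fact
  have lm: "1 \<le> l" "l \<le> n1" "1 \<le> m" "m \<le> n2" using assms(7,8) by auto
  have "class_continuous_at n1 N1 y n2 N2 z 1 1 f a \<longleftrightarrow> class_continuous_at n1 N1 y n2 N2 z l m f a"
    (is "?L \<longleftrightarrow> ?R") for a
  proof
    assume L: ?L
    show ?R
      unfolding class_continuous_at_def
    proof (intro allI impI)
      fix \<epsilon> :: real assume "\<epsilon> > 0"
      \<comment> \<open>Only the target is rescaled: a class-\<open>m\<close> norm adds up
        \<open>m\<close> class-1 norms. The \<delta> obtained serves unchanged, since
        class-\<open>l\<close> norms dominate class-1 norms.\<close>
      then have "\<epsilon> / real m > 0" using lm by simp
      then obtain \<delta> where "\<delta> > 0" and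
        "\<And>x. \<forall>I\<in>class_index n1 1. quot_norm n1 N1 y I (quot_coset n1 y I (x - a)) < \<delta> \<Longrightarrow>
          \<forall>J\<in>class_index n2 1. quot_norm n2 N2 z J (quot_coset n2 z J (f x - f a)) < \<epsilon> / real m"
        using L unfolding class_continuous_at_def by meson
      then show "\<exists>\<delta>>0. \<forall>x.
        (\<forall>I\<in>class_index n1 l. quot_norm n1 N1 y I (quot_coset n1 y I (x - a)) < \<delta>) \<longrightarrow>
        (\<forall>J\<in>class_index n2 m. quot_norm n2 N2 z J (quot_coset n2 z J (f x - f a)) < \<epsilon>)"
        using X.class_norms_mono[OF order_refl lm(1,2)] Z.class_norms_less_of_class_1[OF lm(3)]
        by meson
    qed
  next
    assume R: ?R
    show ?L
      unfolding class_continuous_at_def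
    proof (intro allI impI)
      fix \<epsilon> :: real assume "\<epsilon> > 0"
      then obtain \<delta> where "\<delta> > 0" and \<delta>:
        "\<And>x. \<forall>I\<in>class_index n1 l. quot_norm n1 N1 y I (quot_coset n1 y I (x - a)) < \<delta> \<Longrightarrow>
          \<forall>J\<in>class_index n2 m. quot_norm n2 N2 z J (quot_coset n2 z J (f x - f a)) < \<epsilon>"
        using R unfolding class_continuous_at_def by meson
      \<comment> \<open>Here the source is rescaled instead: class-1 norms below
        \<open>\<delta> / l\<close> force class-\<open>l\<close> norms below \<delta>, while
        \<epsilon> stays the same.\<close>
      have "\<delta> / real l > 0" using \<open>\<delta> > 0\<close> lm by simp
      then show "\<exists>\<delta>>0. \<forall>x.
        (\<forall>I\<in>class_index n1 1. quot_norm n1 N1 y I (quot_coset n1 y I (x - a)) < \<delta>) \<longrightarrow>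
        (\<forall>J\<in>class_index n2 1. quot_norm n2 N2 z J (quot_coset n2 z J (f x - f a)) < \<epsilon>)"
        using \<delta> X.class_norms_less_of_class_1[OF lm(1)] Z.class_norms_mono[OF order_refl lm(3,4)]
        by meson
    qed
  qed
  then show ?thesis by (simp add: class_continuous_def)
qed

end
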